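(* Let $v(x)={}^t\!xQx$ be a positive definite quadratic form on $\mathbb{R}^n$, let $M$ be a nonempty proper subset of $[n]$, $\ell\in M$, $L=\{\ell\}$, $K=M\setminus L$, and fix $\mu^{(K)}\in\mathbb{R}^K$. For $r\in\mathbb{R}$ put $r'=r-\varrho$, $a=\gamma_M(\tau^{(L,K)}(r))$ and $a'=a-\gamma_K(\mu^{(K)})$. Let $p\in\mathbb{R}^{K^c}$ be the $\ell$-th coordinate vector (its $\ell$-th component is $1$, all others are $0$). (i) If $r'\ge0$, then $x(a',r')=c^{(Q;M^c)}(\tau^{(L,K)}(r))$, and $x(0,0)=\varrho^{(K)}$. (ii) One has $\mathrm{Eff}_{\ell^{\varrho+}}^{(Q;M^c)}=\mathrm{Ef}_p^{(Q^{(K^c)})}$. Here the points $x(a',r')$ and the set $\mathrm{Ef}_p^{(Q^{(K^c)})}$ are regarded as lying in the affine space $h^{(K)}=\{x\in\mathbb{R}^n\mid x_j=\mu_j,\ j\in K\}$ with origin $\varrho^{(K)}$, as described in the context.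
   Context: $[n]=\{1,\dots,n\}$; $Q$ is symmetric positive definite. For $S\subsetneq[n]$ with complement $S^c$, $Q^{(S)}$ is the principal submatrix indexed by $S$ and $Q^{(S^c\times S)}$ the submatrix with rows in $S^c$, columns in $S$. For $\tau\in\mathbb{R}^S$, $c^{(Q;S^c)}(\tau)\in\mathbb{R}^n$ has $j$-th component $\tau_j$ for $j\in S$, and its components indexed by $S^c$ form the unique solution $c_{S^c}(\tau)=y$ of $Q^{(S^c)}y=-Q^{(S^c\times S)}\tau$ (it is $0$ for $S=\emptyset$). $\gamma_S(\tau)={}^t\tau Q^{(S)}\tau-{}^tc_{S^c}(\tau)Q^{(S^c)}c_{S^c}(\tau)$, $\gamma_\emptyset=0$. $\tau^{(L,K)}(r)\in\mathbb{R}^M$ has $\ell$-th component $r$ and $j$-th component $\mu_j$ for $j\in K$. $\varrho^{(K)}=c^{(Q;K^c)}(\mu^{(K)})$ and $\varrho=\varrho^{(K)}_\ell$ is its $\ell$-th component. $\mathrm{Eff}_{\ell^{\varrho+}}^{(Q;M^c)}=\{c^{(Q;M^c)}(\tau^{(L,K)}(r))\mid r\ge\varrho\}$. The affine space $h^{(K)}$ is identified with $\mathbb{R}^{K^c}$ by the coordinates $z_s=x_s-\varrho^{(K)}_s$, $s\in K^c$, so its origin is the point $\varrho^{(K)}$. Put $c_p=({}^tp\,(Q^{(K^c)})^{-1}p)^{-1}$ and $E_p=\{(\alpha,\beta)\mid\alpha=c_p\beta^2,\ \beta\ge0\}$. For $(\alpha,\beta)\in E_p$ with $\beta>0$, $x(\alpha,\beta)$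 is the point of $h^{(K)}$ with $z$-coordinate vector $\frac{\alpha}{\beta}(Q^{(K^c)})^{-1}p$, and $x(0,0)$ is the point with $z=0$. $\mathrm{Ef}_p^{(Q^{(K^c)})}=\{x(\alpha,\beta)\mid(\alpha,\beta)\in E_p\}$. Part (i) includes the assertion that $(a',r')\in E_p$, so that $x(a',r')$ is defined. *)

theory Defs
  imports "HOL-Analysis.Analysis"
begin

(* The index set [n] is a finite type 'n.  For S a set of indices, R^S is S \<rightarrow>\<^sub>E UNIV,
   the extensional functions on S, and an I x J matrix is an element of
   I \<rightarrow>\<^sub>E (J \<rightarrow>\<^sub>E UNIV); extensionality makes "the unique vector/matrix" a plain THE. *)

abbreviation vec_space :: "'n set \<Rightarrow> ('n \<Rightarrow> real) set" where
  "vec_space S \<equiv> S \<rightarrow>\<^sub>E UNIV"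

definition quad_form :: "real^'n^'n \<Rightarrow> real^'n \<Rightarrow> real" where
  "quad_form Q x = x \<bullet> (Q *v x)"

definition sym_pos_def :: "real^'n^'n \<Rightarrow> bool" where
  "sym_pos_def Q \<longleftrightarrow> transpose Q = Q \<and> (\<forall>x. x \<noteq> 0 \<longrightarrow> quad_form Q x > 0)"

definition submat :: "real^'n^'n \<Rightarrow> 'n set \<Rightarrow> 'n set \<Rightarrow> 'n \<Rightarrow> 'n \<Rightarrow> real" where
  "submat Q I J = (\<lambda>i\<in>I. \<lambda>j\<in>J. Q $ i $ j)"

definition mult_vec_on ::
    "'n set \<Rightarrow> 'n set \<Rightarrow> ('n \<Rightarrow> 'n \<Rightarrow> real) \<Rightarrow> ('n \<Rightarrow> real) \<Rightarrow> 'n \<Rightarrow> real" where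
  "mult_vec_on I J A y = (\<lambda>i\<in>I. \<Sum>j\<in>J. A i j * y j)"

definition dot_on :: "'n set \<Rightarrow> ('n \<Rightarrow> real) \<Rightarrow> ('n \<Rightarrow> real) \<Rightarrow> real" where
  "dot_on S x y = (\<Sum>i\<in>S. x i * y i)"

definition inverse_on :: "'n set \<Rightarrow> ('n \<Rightarrow> 'n \<Rightarrow> real) \<Rightarrow> 'n \<Rightarrow> 'n \<Rightarrow> real" where
  "inverse_on S A = (THE B. B \<in> S \<rightarrow>\<^sub>E vec_space S \<and>
     (\<forall>i\<in>S. \<forall>j\<in>S. (\<Sum>k\<in>S. A i k * B k j) = (if i = j then 1 else 0)) \<and>
     (\<forall>i\<in>S. \<forall>j\<in>S. (\<Sum>k\<in>S. B i k * A k j) = (if i = j then 1 else 0)))"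

(* The point c^{(Q;S^c)}(\<tau>) is c_point Q S \<tau>: it is indexed by S, not by its complement.
   For positive definite Q the solution in c_compl exists, is unique, and is 0 when S = {}. *)

definition c_compl :: "real^'n^'n \<Rightarrow> 'n set \<Rightarrow> ('n \<Rightarrow> real) \<Rightarrow> 'n \<Rightarrow> real" where
  "c_compl Q S \<tau> = (THE y. y \<in> vec_space (- S) \<and>
     mult_vec_on (- S) (- S) (submat Q (- S) (- S)) y
       = (\<lambda>i\<in>- S. - mult_vec_on (- S) S (submat Q (- S) S) \<tau> i))"

definition c_point :: "real^'n^'n \<Rightarrow> 'n set \<Rightarrow> ('n \<Rightarrow> real) \<Rightarrow> real^'n" where
  "c_point Q S \<tau> = (\<chi> j. if j \<in> S then \<tau> j else c_compl Q S \<tau> j)"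

definition gamma_val :: "real^'n^'n \<Rightarrow> 'n set \<Rightarrow> ('n \<Rightarrow> real) \<Rightarrow> real" where
  "gamma_val Q S \<tau> =
     dot_on S \<tau> (mult_vec_on S S (submat Q S S) \<tau>)
     - dot_on (- S) (c_compl Q S \<tau>)
         (mult_vec_on (- S) (- S) (submat Q (- S) (- S)) (c_compl Q S \<tau>))"

definition tau_ext :: "'n \<Rightarrow> 'n set \<Rightarrow> ('n \<Rightarrow> real) \<Rightarrow> real \<Rightarrow> 'n \<Rightarrow> real" where
  "tau_ext l K \<mu> r = (\<lambda>j\<in>insert l K. if j = l then r else \<mu> j)"

definition rho_point :: "real^'n^'n \<Rightarrow> 'n set \<Rightarrow> ('n \<Rightarrow> real) \<Rightarrow> real^'n" where
  "rho_point Q K \<mu> = c_point Q K \<mu>"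

definition Eff_plus :: "real^'n^'n \<Rightarrow> 'n \<Rightarrow> 'n set \<Rightarrow> ('n \<Rightarrow> real) \<Rightarrow> (real^'n) set" where
  "Eff_plus Q l K \<mu> =
     {c_point Q (insert l K) (tau_ext l K \<mu> r) |r. r \<ge> rho_point Q K \<mu> $ l}"

definition h_space :: "'n set \<Rightarrow> ('n \<Rightarrow> real) \<Rightarrow> (real^'n) set" where
  "h_space K \<mu> = {x. \<forall>j\<in>K. x $ j = \<mu> j}"

definition z_coord :: "real^'n^'n \<Rightarrow> 'n set \<Rightarrow> ('n \<Rightarrow> real) \<Rightarrow> real^'n \<Rightarrow> 'n \<Rightarrow> real" where
  "z_coord Q K \<mu> x = (\<lambda>s\<in>- K. x $ s - rho_point Q K \<mu> $ s)"

definition z_point :: "real^'n^'n \<Rightarrow> 'n set \<Rightarrow> ('n \<Rightarrow> real) \<Rightarrow> ('n \<Rightarrow> real) \<Rightarrow> real^'n" where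
  "z_point Q K \<mu> = the_inv_into (h_space K \<mu>) (z_coord Q K \<mu>)"

definition inv_times_p :: "real^'n^'n \<Rightarrow> 'n set \<Rightarrow> ('n \<Rightarrow> real) \<Rightarrow> 'n \<Rightarrow> real" where
  "inv_times_p Q K p =
     mult_vec_on (- K) (- K) (inverse_on (- K) (submat Q (- K) (- K))) p"

definition c_p :: "real^'n^'n \<Rightarrow> 'n set \<Rightarrow> ('n \<Rightarrow> real) \<Rightarrow> real" where
  "c_p Q K p = inverse (dot_on (- K) p (inv_times_p Q K p))"

definition E_p :: "real^'n^'n \<Rightarrow> 'n set \<Rightarrow> ('n \<Rightarrow> real) \<Rightarrow> (real \<times> real) set" where
  "E_p Q K p = {(\<alpha>, \<beta>). \<alpha> = c_p Q K p * \<beta>\<^sup>2 \<and> \<beta> \<ge> 0}"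

(* Meaningful only for (\<alpha>, \<beta>) in E_p, where the second branch is exactly (0, 0). *)

definition x_point ::
    "real^'n^'n \<Rightarrow> 'n set \<Rightarrow> ('n \<Rightarrow> real) \<Rightarrow> ('n \<Rightarrow> real) \<Rightarrow> real \<Rightarrow> real \<Rightarrow> real^'n" where
  "x_point Q K \<mu> p \<alpha> \<beta> =
     (if \<beta> > 0 then z_point Q K \<mu> (\<lambda>s\<in>- K. \<alpha> / \<beta> * inv_times_p Q K p s)
      else z_point Q K \<mu> (\<lambda>s\<in>- K. 0))"

definition Ef_p :: "real^'n^'n \<Rightarrow> 'n set \<Rightarrow> ('n \<Rightarrow> real) \<Rightarrow> ('n \<Rightarrow> real) \<Rightarrow> (real^'n) set" where
  "Ef_p Q K \<mu> p = {x_point Q K \<mu> p \<alpha> \<beta> |\<alpha> \<beta>. (\<alpha>, \<beta>) \<in> E_p Q K p}"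

definition unit_vec_on :: "'n set \<Rightarrow> 'n \<Rightarrow> 'n \<Rightarrow> real" where
  "unit_vec_on S l = (\<lambda>s\<in>S. if s = l then 1 else 0)"

end

theory Submission imports Defs begin

text \<open>
  The point \<open>c_point Q S \<tau>\<close> is the unique \<open>x\<close> with \<open>x = \<tau>\<close> on \<open>S\<close> and \<open>Qx = 0\<close> off \<open>S\<close>,
  and \<open>gamma_val Q S \<tau>\<close> is the value of the form there. Let \<open>u\<close> vanish on \<open>K\<close> and satisfy
  \<open>Qu = p\<close> off \<open>K\<close>; on \<open>- K\<close> it is
  the inverse principal submatrix applied to \<open>p\<close>, so \<open>c_p = 1 / u\<^sub>l\<close>.
  Along the line \<open>\<varrho> + t u\<close> the vector \<open>Qx\<close> is \<open>t p\<close> off \<open>K\<close>, hence these points are exactly the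
  \<open>c_point Q M\<close> with \<open>l\<close>-th coordinate \<open>\<varrho>\<^sub>l + t u\<^sub>l\<close>. As \<open>u\<close> and \<open>Q\<varrho>\<close> have disjoint supports,
  the form grows by \<open>t\<^sup>2 u\<^sub>l = c_p (t u\<^sub>l)\<^sup>2\<close>.
\<close>

section \<open>Positive definite systems with mixed data\<close>

lemma matrix_vector_mult_nth_supported:
  fixes Q :: "real^'n^'n"
  assumes "\<And>j. j \<notin> S \<Longrightarrow> x $ j = 0"
  shows "(Q *v x) $ i = (\<Sum>j\<in>S. Q $ i $ j * x $ j)"
  unfolding matrix_vector_mult_def
  by (simp, rule sum.mono_neutral_right) (use assms in auto)

lemma sym_inner_matrix_vector:
  fixes Q :: "real^'n^'n"
  assumes "transpose Q = Q"
  shows "x \<bullet> (Q *v y) = y \<bullet> (Q *v x)"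
  using assms by (metis dot_lmul_matrix inner_commute transpose_matrix_vector)

text \<open>Meant for \<open>y = Q *v u\<close>, whose entries on \<open>K\<close> are unknown: the
  zeros of \<open>x\<close> cancel them.\<close>

lemma inner_eq_nth:
  fixes x y :: "real^'n"
  assumes "\<And>i. i \<in> K \<Longrightarrow> x $ i = 0"
    and "\<And>i. i \<notin> K \<Longrightarrow> y $ i = (if i = j then 1 else 0)" and "j \<notin> K"
  shows "x \<bullet> y = x $ j"
proof -
  have "x $ i * y $ i = (if i = j then x $ i else 0)" for i
    using assms by (cases "i \<in> K") auto
  then show ?thesis by (simp add: inner_vec_def)
qed

lemma sym_pos_def_nth_commute:
  assumes "sym_pos_def Q"
  shows "Q $ i $ j = Q $ j $ i"
proof -
  have "transpose Q $ i $ j = Q $ i $ j"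
    using assms by (simp add: sym_pos_def_def)
  then show ?thesis by (simp add: transpose_def)
qed

text \<open>Each summand of \<open>x \<bullet> (Q *v x)\<close> has a zero factor, so the form
  vanishes at \<open>x\<close>. All uniqueness claims about \<open>Q\<close> rest on this.\<close>

lemma sym_pos_def_eq_0:
  fixes Q :: "real^'n^'n"
  assumes Q: "sym_pos_def Q" and "\<And>i. x $ i = 0 \<or> (Q *v x) $ i = 0"
  shows "x = 0"
proof -
  have "quad_form Q x = 0"
    unfolding quad_form_def inner_vec_def by (rule sum.neutral) (use assms(2) in auto)
  then show ?thesis
    using Q unfolding sym_pos_def_def by (metis less_irrefl)
qed

text \<open>Sending \<open>x\<close> to its entries on \<open>S\<close> and those of
  \<open>Q *v x\<close> off \<open>S\<close> is a linear endomorphism with trivial kernel, hence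
  onto in finite dimension. It supplies both the origin and the direction of the line.\<close>

lemma sym_pos_def_mixed_system:
  fixes Q :: "real^'n^'n"
  assumes Q: "sym_pos_def Q"
  obtains x where "\<And>i. i \<in> S \<Longrightarrow> x $ i = f i" "\<And>i. i \<notin> S \<Longrightarrow> (Q *v x) $ i = f i"
proof -
  define T where "T x = (\<chi> i. if i \<in> S then x $ i else (Q *v x) $ i)" for x :: "real^'n"
  have lin: "linear T"
    by (rule linearI)
      (auto simp: T_def vec_eq_iff matrix_vector_right_distrib matrix_vector_mult_scaleR)
  have "inj T"
  proof (rule linear_injective_0[OF lin, THEN iffD2], intro allI impI)
    fix x assume "T x = 0"
    then show "x = 0"
      by (intro sym_pos_def_eq_0[OF Q]) (auto simp: T_def vec_eq_iff split: if_splits)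
  qed
  then have "surj T"
    using lin linear_injective_imp_surjective by blast
  then obtain x where "T x = (\<chi> i. f i)"
    by (metis surjD)
  then have "(if i \<in> S then x $ i else (Q *v x) $ i) = f i" for i
    by (simp add: T_def vec_eq_iff)
  then show thesis
    by (intro that[of x]) (metis (full_types))+
qed

section \<open>The points \<open>c_point\<close> and the values \<open>gamma_val\<close>\<close>

lemma sum_UNIV_split:
  fixes f :: "'n::finite \<Rightarrow> real"
  shows "sum f UNIV = sum f S + sum f (- S)"
  using sum.union_disjoint[of S "- S" f] by (simp add: Compl_partition)

text \<open>Moving the columns in \<open>S\<close> to the left side turns the block system for the
  complement into the vanishing of \<open>Q *v x\<close> off \<open>S\<close>.\<close>

lemma c_compl_eq:
  fixes Q :: "real^'n^'n"
  assumes Q: "sym_pos_def Q"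
    and x: "\<And>i. i \<in> S \<Longrightarrow> x $ i = \<tau> i" "\<And>i. i \<notin> S \<Longrightarrow> (Q *v x) $ i = 0"
  shows "c_compl Q S \<tau> = (\<lambda>i\<in>- S. x $ i)"
  unfolding c_compl_def
proof (rule the_equality, rule conjI)
  show "(\<lambda>i\<in>- S. x $ i) \<in> vec_space (- S)"
    by simp
  have "(\<Sum>j\<in>- S. Q $ i $ j * x $ j) = - (\<Sum>j\<in>S. Q $ i $ j * \<tau> j)" if "i \<notin> S" for i
    using x(2)[OF that] x(1) sum_UNIV_split[of "\<lambda>j. Q $ i $ j * x $ j" S]
    by (simp add: matrix_vector_mult_def)
  then show "mult_vec_on (- S) (- S) (submat Q (- S) (- S)) (\<lambda>i\<in>- S. x $ i)
      = (\<lambda>i\<in>- S. - mult_vec_on (- S) S (submat Q (- S) S) \<tau> i)"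
    by (auto simp: mult_vec_on_def submat_def)
next
  fix y assume "y \<in> vec_space (- S) \<and>
    mult_vec_on (- S) (- S) (submat Q (- S) (- S)) y
      = (\<lambda>i\<in>- S. - mult_vec_on (- S) S (submat Q (- S) S) \<tau> i)"
  then have ext: "y \<in> vec_space (- S)"
    and y: "mult_vec_on (- S) (- S) (submat Q (- S) (- S)) y
      = (\<lambda>i\<in>- S. - mult_vec_on (- S) S (submat Q (- S) S) \<tau> i)"
    by blast+
  \<comment> \<open>Gluing \<open>\<tau>\<close> to a competing solution gives a full vector with
    the same mixed data as \<open>x\<close>, so the difference is zero.\<close>
  define z where "z = (\<chi> i. if i \<in> S then \<tau> i else y i)"
  have "(Q *v z) $ i = 0" if "i \<notin> S" for i
    using fun_cong[OF y, of i] that sum_UNIV_split[of "\<lambda>j. Q $ i $ j * z $ j" S]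
    by (simp add: matrix_vector_mult_def mult_vec_on_def submat_def z_def)
  then have "x - z = 0"
    using x by (intro sym_pos_def_eq_0[OF Q])
      (auto simp: z_def[THEN arg_cong[where f="\<lambda>v. v $ _"]] matrix_vector_mult_diff_distrib)
  then have "x = z" by simp
  then show "y = (\<lambda>i\<in>- S. x $ i)"
    using ext by (auto simp: z_def PiE_def extensional_def)
qed

lemma c_point_eq:
  fixes Q :: "real^'n^'n"
  assumes "sym_pos_def Q"
    and "\<And>i. i \<in> S \<Longrightarrow> x $ i = \<tau> i" "\<And>i. i \<notin> S \<Longrightarrow> (Q *v x) $ i = 0"
  shows "c_point Q S \<tau> = x"
  using assms by (simp add: c_point_def c_compl_eq[of Q S x] vec_eq_iff)

text \<open>Split the form into four blocks \<open>B\<close>. Since \<open>Q *v x\<close> vanishes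
  off \<open>S\<close>, the two blocks with rows off \<open>S\<close> cancel; by symmetry the
  negated complement block is then the missing block \<open>B S (- S)\<close>.\<close>

lemma gamma_val_eq:
  fixes Q :: "real^'n^'n"
  assumes Q: "sym_pos_def Q"
    and x: "\<And>i. i \<in> S \<Longrightarrow> x $ i = \<tau> i" "\<And>i. i \<notin> S \<Longrightarrow> (Q *v x) $ i = 0"
  shows "gamma_val Q S \<tau> = quad_form Q x"
proof -
  define B where "B I J = (\<Sum>i\<in>I. x $ i * (\<Sum>j\<in>J. Q $ i $ j * x $ j))" for I J
  note sym = sym_pos_def_nth_commute[OF Q]
  have B_sym: "B S (- S) = B (- S) S"
    unfolding B_def sum_distrib_left
    by (subst sum.swap) (auto intro!: sum.cong simp: sym)
  have row: "(Q *v x) $ i = (\<Sum>j\<in>S. Q $ i $ j * x $ j) + (\<Sum>j\<in>- S. Q $ i $ j * x $ j)" for i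
    by (simp add: matrix_vector_mult_def flip: sum_UNIV_split)
  have off: "B (- S) S + B (- S) (- S) = 0"
    unfolding B_def sum.distrib[symmetric] distrib_left[symmetric] row[symmetric]
    using x(2) by simp
  have "c_compl Q S \<tau> = (\<lambda>i\<in>- S. x $ i)"
    using x by (rule c_compl_eq[OF Q])
  then have "gamma_val Q S \<tau> = B S S - B (- S) (- S)"
    by (simp add: gamma_val_def dot_on_def mult_vec_on_def submat_def B_def x(1))
  also have "\<dots> = B S S + B S (- S)"
    using off B_sym by simp
  also have "\<dots> = (\<Sum>i\<in>S. x $ i * (Q *v x) $ i)"
    unfolding B_def sum.distrib[symmetric] distrib_left[symmetric] row[symmetric] ..
  also have "\<dots> = quad_form Q x"
    using x(2) sum_UNIV_split[of "\<lambda>i. x $ i * (Q *v x) $ i" S]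
    by (simp add: quad_form_def inner_vec_def)
  finally show ?thesis .
qed

section \<open>The inverse of a principal submatrix\<close>

lemma inverse_on_eq:
  assumes B: "B \<in> S \<rightarrow>\<^sub>E vec_space S"
    and right: "\<forall>i\<in>S. \<forall>j\<in>S. (\<Sum>k\<in>S. A i k * B k j) = (if i = j then 1 else 0)"
    and left: "\<forall>i\<in>S. \<forall>j\<in>S. (\<Sum>k\<in>S. B i k * A k j) = (if i = j then 1 else 0)"
    and fin: "finite S"
  shows "inverse_on S A = B"
  unfolding inverse_on_def
proof (rule the_equality)
  fix C assume C: "C \<in> S \<rightarrow>\<^sub>E vec_space S \<and>
     (\<forall>i\<in>S. \<forall>j\<in>S. (\<Sum>k\<in>S. A i k * C k j) = (if i = j then 1 else 0)) \<and>
     (\<forall>i\<in>S. \<forall>j\<in>S. (\<Sum>k\<in>S. C i k * A k j) = (if i = j then 1 else 0))"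
  \<comment> \<open>Associativity in coordinates: \<open>C = (B A) C = B (A C) = B\<close>.\<close>
  have "C i j = B i j" if "i \<in> S" "j \<in> S" for i j
  proof -
    have "C i j = (\<Sum>k\<in>S. (if i = k then 1 else 0) * C k j)"
      using that fin by (simp add: if_distrib[of "\<lambda>t. t * _"] cong: if_cong)
    also have "\<dots> = (\<Sum>k\<in>S. (\<Sum>m\<in>S. B i m * A m k) * C k j)"
      using left that by (intro sum.cong) auto
    also have "\<dots> = (\<Sum>m\<in>S. B i m * (\<Sum>k\<in>S. A m k * C k j))"
      unfolding sum_distrib_left sum_distrib_right by (subst sum.swap) (simp add: mult.assoc)
    also have "\<dots> = (\<Sum>m\<in>S. B i m * (if m = j then 1 else 0))"
      using C that by (intro sum.cong) auto
    also have "\<dots> = B i j"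
      using that fin by (simp add: if_distrib[of "\<lambda>t. _ * t"] cong: if_cong)
    finally show ?thesis .
  qed
  moreover have "C \<in> S \<rightarrow>\<^sub>E vec_space S" using C by blast
  ultimately show "C = B"
    using B by (intro PiE_ext[of C S _ B]) (auto intro!: PiE_ext[of _ S "\<lambda>_. UNIV"])
qed (use assms in blast)

text \<open>The vector \<open>u\<close> is column \<open>l\<close> of the inverse, extended by zero
  to \<open>K\<close>. The proof builds every column, because identifying \<open>inverse_on\<close>
  takes the full matrix.\<close>

lemma inv_times_unit_vec_on:
  fixes Q :: "real^'n^'n"
  assumes Q: "sym_pos_def Q" and l: "l \<notin> K"
  obtains u where "\<And>i. i \<in> K \<Longrightarrow> u $ i = 0"
    and "\<And>i. i \<notin> K \<Longrightarrow> (Q *v u) $ i = (if i = l then 1 else 0)"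
    and "inv_times_p Q K (unit_vec_on (- K) l) = (\<lambda>s\<in>- K. u $ s)"
proof -
  have "\<exists>x. (\<forall>i\<in>K. x $ i = 0) \<and> (\<forall>i. i \<notin> K \<longrightarrow> (Q *v x) $ i = (if i = j then 1 else 0))" for j
  proof -
    obtain x where x: "\<And>i. i \<in> K \<Longrightarrow> x $ i = (if i \<in> K then 0 else if i = j then 1 else 0)"
      "\<And>i. i \<notin> K \<Longrightarrow> (Q *v x) $ i = (if i \<in> K then 0 else if i = j then 1 else 0)"
      by (rule sym_pos_def_mixed_system[OF Q,
        of K "\<lambda>i. if i \<in> K then 0 else if i = j then 1 else 0"]) blast
    then show ?thesis by (intro exI[of _ x]) auto
  qed
  then obtain X where X0: "\<And>i j. i \<in> K \<Longrightarrow> X j $ i = 0"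
    and QX: "\<And>i j. i \<notin> K \<Longrightarrow> (Q *v X j) $ i = (if i = j then 1 else 0)"
    by metis
  note sym = sym_pos_def_nth_commute[OF Q]
  have row: "(Q *v X j) $ i = (\<Sum>k\<in>- K. Q $ i $ k * X j $ k)" for i j
    by (rule matrix_vector_mult_nth_supported) (simp add: X0)
  have inner_X: "X i \<bullet> (Q *v X j) = X i $ j" if "j \<notin> K" for i j
    using X0 QX that by (intro inner_eq_nth[of K]) auto
  \<comment> \<open>Both entries equal the bilinear form at \<open>X i\<close> and
    \<open>X j\<close>.\<close>
  have X_sym: "X i $ j = X j $ i" if "i \<notin> K" "j \<notin> K" for i j
    using inner_X that sym_inner_matrix_vector Q unfolding sym_pos_def_def by metis
  have inv: "inverse_on (- K) (submat Q (- K) (- K)) = (\<lambda>i\<in>- K. \<lambda>j\<in>- K. X j $ i)"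
  proof (rule inverse_on_eq)
    show "\<forall>i\<in>- K. \<forall>j\<in>- K. (\<Sum>k\<in>- K. submat Q (- K) (- K) i k * (\<lambda>i\<in>- K. \<lambda>j\<in>- K. X j $ i) k j)
        = (if i = j then 1 else 0)"
      using row QX by (simp add: submat_def)
    \<comment> \<open>Symmetry of \<open>X\<close> and of \<open>Q\<close> reduces the left inverse
      to the right one.\<close>
    have "(\<Sum>k\<in>- K. X k $ i * Q $ k $ j) = (if i = j then 1 else 0)"
      if "i \<notin> K" "j \<notin> K" for i j
    proof -
      have "(\<Sum>k\<in>- K. X k $ i * Q $ k $ j) = (\<Sum>k\<in>- K. Q $ j $ k * X i $ k)"
        using that by (intro sum.cong) (simp_all add: X_sym[of i] sym[of j])
      then show ?thesis using row[of i j] QX[of j i] that by auto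
    qed
    then show "\<forall>i\<in>- K. \<forall>j\<in>- K. (\<Sum>k\<in>- K. (\<lambda>i\<in>- K. \<lambda>j\<in>- K. X j $ i) i k * submat Q (- K) (- K) k j)
        = (if i = j then 1 else 0)"
      by (simp add: submat_def)
  qed auto
  show thesis
  proof (rule that)
    show "inv_times_p Q K (unit_vec_on (- K) l) = (\<lambda>s\<in>- K. X l $ s)"
      unfolding inv_times_p_def inv using l
      by (auto simp: mult_vec_on_def unit_vec_on_def if_distrib[of "\<lambda>t. _ * t"]
          cong: if_cong)
  qed (use X0 QX in auto)
qed

section \<open>Coordinates on the affine space and the comparison of the two curves\<close>

lemma z_point_eq:
  assumes "x \<in> h_space K \<mu>" and "z_coord Q K \<mu> x = z"
  shows "z_point Q K \<mu> z = x"
proof -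
  have "inj_on (z_coord Q K \<mu>) (h_space K \<mu>)"
  proof (rule inj_onI)
    fix x y assume h: "x \<in> h_space K \<mu>" "y \<in> h_space K \<mu>"
      and z: "z_coord Q K \<mu> x = z_coord Q K \<mu> y"
    show "x = y"
      unfolding vec_eq_iff
    proof
      fix i show "x $ i = y $ i"
        using h fun_cong[OF z, of i] by (cases "i \<in> K") (auto simp: h_space_def z_coord_def)
    qed
  qed
  then show ?thesis
    unfolding z_point_def using assms by (intro the_inv_into_f_eq) auto
qed

theorem theorem4p1p1:
  fixes Q :: "real^'n^'n" and M K :: "'n set" and l :: 'n
    and \<mu> p :: "'n \<Rightarrow> real"
  assumes "sym_pos_def Q"
    and "M \<noteq> {}" and "M \<subset> UNIV" and "l \<in> M"
    and "K = M - {l}"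
    and "\<mu> \<in> vec_space K"
    and "p = unit_vec_on (- K) l"
  shows "(\<forall>r. let r' = r - rho_point Q K \<mu> $ l;
                  a = gamma_val Q M (tau_ext l K \<mu> r);
                  a' = a - gamma_val Q K \<mu>
              in r' \<ge> 0 \<longrightarrow>
                   (a', r') \<in> E_p Q K p \<and>
                   x_point Q K \<mu> p a' r' = c_point Q M (tau_ext l K \<mu> r))
         \<and> x_point Q K \<mu> p 0 0 = rho_point Q K \<mu>
         \<and> Eff_plus Q l K \<mu> = Ef_p Q K \<mu> p"
proof -
  have lK: "l \<notin> K" and MK: "M = insert l K"
    using assms(4,5) by auto
  note Q = assms(1)
  define \<rho> where "\<rho> = rho_point Q K \<mu>"
  obtain u where u0: "\<And>i. i \<in> K \<Longrightarrow> u $ i = 0"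
    and Qu: "\<And>i. i \<notin> K \<Longrightarrow> (Q *v u) $ i = (if i = l then 1 else 0)"
    and inv: "inv_times_p Q K p = (\<lambda>s\<in>- K. u $ s)"
    using inv_times_unit_vec_on[OF Q lK] unfolding assms(7) by blast
  obtain x0 where x0: "\<And>i. i \<in> K \<Longrightarrow> x0 $ i = (if i \<in> K then \<mu> i else 0)"
    "\<And>i. i \<notin> K \<Longrightarrow> (Q *v x0) $ i = (if i \<in> K then \<mu> i else 0)"
    using sym_pos_def_mixed_system[OF Q, of K "\<lambda>i. if i \<in> K then \<mu> i else 0"] by blast
  have "\<rho> = x0"
    unfolding \<rho>_def rho_point_def using x0 by (intro c_point_eq[OF Q]) auto
  with x0 have rho: "\<And>i. i \<in> K \<Longrightarrow> \<rho> $ i = \<mu> i" "\<And>i. i \<notin> K \<Longrightarrow> (Q *v \<rho>) $ i = 0"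
    by auto
  \<comment> \<open>The entry \<open>u $ l\<close> is the value of the form at \<open>u\<close>,
    hence positive; this justifies the later divisions by it.\<close>
  have u_inner: "u \<bullet> (Q *v u) = u $ l"
    using u0 Qu lK by (intro inner_eq_nth[of K]) auto
  have "u \<noteq> 0"
    using Qu[OF lK] by auto
  then have ul: "u $ l > 0"
    using Q u_inner unfolding sym_pos_def_def quad_form_def by metis
  have cp: "c_p Q K p = 1 / u $ l"
  proof -
    have "dot_on (- K) p f = f l" for f
      using lK by (simp add: dot_on_def assms(7) unit_vec_on_def if_distrib[of "\<lambda>t. t * _"]
          cong: if_cong)
    then show ?thesis
      using lK by (simp add: c_p_def inv inverse_eq_divide)
  qed
  have u_rho: "u \<bullet> (Q *v \<rho>) = 0"
    unfolding inner_vec_def by (rule sum.neutral) (use u0 rho(2) in auto)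
  then have rho_u: "\<rho> \<bullet> (Q *v u) = 0"
    using sym_inner_matrix_vector Q unfolding sym_pos_def_def by metis
  have quad_line: "quad_form Q (\<rho> + t *\<^sub>R u) = quad_form Q \<rho> + t\<^sup>2 * u $ l" for t
    by (simp add: quad_form_def matrix_vector_right_distrib matrix_vector_mult_scaleR
        inner_add_left inner_add_right u_rho rho_u u_inner power2_eq_square)
  \<comment> \<open>The parameter at which the line reaches \<open>l\<close>-th coordinate
    \<open>r\<close>.\<close>
  define t where "t r = (r - \<rho> $ l) / u $ l" for r
  have line: "(\<rho> + t r *\<^sub>R u) $ i = tau_ext l K \<mu> r i" if "i \<in> M" for r i
    using that lK ul rho(1) u0 by (auto simp: tau_ext_def MK t_def)
  \<comment> \<open>Off \<open>K\<close>, \<open>Q *v u\<close> is nonzero only at \<open>l\<close>,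
    and \<open>l\<close> lies in \<open>M\<close>.\<close>
  have Qline: "(Q *v (\<rho> + t r *\<^sub>R u)) $ i = 0" if "i \<notin> M" for r i
    using that rho(2) Qu by (auto simp: MK matrix_vector_right_distrib matrix_vector_mult_scaleR)
  have c_M: "c_point Q M (tau_ext l K \<mu> r) = \<rho> + t r *\<^sub>R u" for r
    by (rule c_point_eq[OF Q]) (use line Qline in auto)
  have gamma_M: "gamma_val Q M (tau_ext l K \<mu> r) - gamma_val Q K \<mu> = c_p Q K p * (r - \<rho> $ l)\<^sup>2"
    for r
  proof -
    have "gamma_val Q M (tau_ext l K \<mu> r) = quad_form Q (\<rho> + t r *\<^sub>R u)"
      by (rule gamma_val_eq[OF Q]) (use line Qline in auto)
    moreover have "gamma_val Q K \<mu> = quad_form Q \<rho>"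
      by (rule gamma_val_eq[OF Q]) (use rho in auto)
    ultimately show ?thesis
      using ul by (simp add: quad_line cp t_def power2_eq_square)
  qed
  have z_line: "z_point Q K \<mu> (\<lambda>s\<in>- K. b * u $ s) = \<rho> + b *\<^sub>R u" for b
    by (rule z_point_eq) (use rho u0 in \<open>auto simp: h_space_def z_coord_def \<rho>_def\<close>)
  \<comment> \<open>For \<open>\<beta> > 0\<close> the factor \<open>\<alpha> / \<beta>\<close> is
    \<open>\<beta> / u $ l\<close>; the separate branch at zero agrees with this formula, giving the
    origin.\<close>
  have x_E: "x_point Q K \<mu> p (c_p Q K p * \<beta>\<^sup>2) \<beta> = \<rho> + (\<beta> / u $ l) *\<^sub>R u" if "\<beta> \<ge> 0" for \<beta>
  proof (cases "\<beta> > 0")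
    case True
    have "(\<lambda>s\<in>- K. c_p Q K p * \<beta>\<^sup>2 / \<beta> * inv_times_p Q K p s) = (\<lambda>s\<in>- K. \<beta> / u $ l * u $ s)"
      using True by (auto simp: inv cp power2_eq_square)
    then show ?thesis
      using True z_line[of "\<beta> / u $ l"] by (simp add: x_point_def)
  next
    case False
    then show ?thesis
      using that z_line[of 0] by (simp add: x_point_def)
  qed
  \<comment> \<open>The shift \<open>\<beta> = r - \<rho> $ l\<close> matches the parameters of the
    two sets; both parts of the theorem follow from it.\<close>
  have x_M: "x_point Q K \<mu> p (c_p Q K p * (r - \<rho> $ l)\<^sup>2) (r - \<rho> $ l)
      = c_point Q M (tau_ext l K \<mu> r)" if "r \<ge> \<rho> $ l" for r
    using x_E[of "r - \<rho> $ l"] that by (simp add: c_M t_def)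
  have "Eff_plus Q l K \<mu> = Ef_p Q K \<mu> p"
  proof (intro equalityI subsetI)
    fix x assume "x \<in> Eff_plus Q l K \<mu>"
    then obtain r where "r \<ge> \<rho> $ l" "x = c_point Q M (tau_ext l K \<mu> r)"
      unfolding Eff_plus_def MK \<rho>_def by blast
    then show "x \<in> Ef_p Q K \<mu> p"
      using x_M[of r] unfolding Ef_p_def E_p_def
      by (auto intro!: exI[of _ "c_p Q K p * (r - \<rho> $ l)\<^sup>2"] exI[of _ "r - \<rho> $ l"])
  next
    fix x assume "x \<in> Ef_p Q K \<mu> p"
    then obtain \<beta> where "\<beta> \<ge> 0" "x = x_point Q K \<mu> p (c_p Q K p * \<beta>\<^sup>2) \<beta>"
      unfolding Ef_p_def E_p_def by blast
    then show "x \<in> Eff_plus Q l K \<mu>"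
      using x_M[of "\<rho> $ l + \<beta>"] unfolding Eff_plus_def MK \<rho>_def
      by (auto intro!: exI[of _ "\<rho> $ l + \<beta>"] simp: \<rho>_def)
  qed
  moreover have "x_point Q K \<mu> p 0 0 = \<rho>"
    using x_E[of 0] by simp
  ultimately show ?thesis
    using x_M by (simp add: Let_def gamma_M E_p_def flip: \<rho>_def)
qed

end
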